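(* Let $f$ be a twist map of the annulus, let $c\in\mathbb{R}$, and let $u_c:\mathbb{R}\to\mathbb{R}$ be a discrete weak K.A.M. solution for $f$ at cohomology class $c$. Then the graphs $\operatorname{Graph}(\Sigma_+)$, $\operatorname{Graph}(c+dT^+[u_c])$ and $\operatorname{Graph}(c+\nabla^+u_c)$ are Lipschitz submanifolds of $\mathbb{R}^2$, and they are associated by the commutative diagram consisting of the maps $$\Gamma^-:\operatorname{Graph}(\Sigma_+)\to\operatorname{Graph}(c+dT^+[u_c]),\quad \Gamma^+:\operatorname{Graph}(\Sigma_+)\to\operatorname{Graph}(c+\nabla^+u_c),\quad F:\operatorname{Graph}(c+dT^+[u_c])\to\operatorname{Graph}(c+\nabla^+u_c),$$ that is, $F\circ\Gamma^-=\Gamma^+$ on $\operatorname{Graph}(\Sigma_+)$, where $\Gamma^+(x,y)=(y,\partial_2S(x,y))$, $\Gamma^-(x,y)=(x,-\partial_1S(x,y))$ and $F$ is the lift of $f$ associated to $S$.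
   Context: Let $\mathbb{T}=\mathbb{R}/\mathbb{Z}$. A twist map of the annulus is a $C^1$-diffeomorphism $f:\mathbb{T}\times\mathbb{R}\to\mathbb{T}\times\mathbb{R}$ such that: (1) $f$ is isotopic to the identity; (2) $f$ is exact symplectic, i.e. if $f(\theta,p)=(\theta',p')$ then the $1$-form $p'd\theta'-p\,d\theta$ is exact; (3) if $F:\mathbb{R}^2\to\mathbb{R}^2$, $F(x,p)=(y,p')$, is a lift of $f$, there is $\varepsilon>0$ with $0<\frac{\partial y}{\partial p}(x,p)<\frac1\varepsilon$ for all $(x,p)$. Fix a lift $F$ of $f$. Its generating function is a $C^2$ function $S:\mathbb{R}^2\to\mathbb{R}$ (which exists and is unique up to an additive constant) such that $S(x+1,y+1)=S(x,y)$; there is $\varepsilon>0$ with $\frac{\partial^2S}{\partial x\partial y}<-\varepsilon$ everywhere; and $F(x,p)=(y,p')$ if and only if $p=-\partial_1S(x,y)$ and $p'=\partial_2S(x,y)$. For $c\in\mathbb{R}$ put $S_c(x,y)=S(x,y)+c(x-y)$. For a bounded $1$-periodic $u:\mathbb{R}\to\mathbb{R}$ put $T^-[u](x)=\inf_{y\in\mathbb{R}}\{u(y)+S_c(y,x)\}$ and $T^+[u](x)=\sup_{y\in\mathbb{R}}\{u(y)-S_c(x,y)\}$. There is a unique constant $\overline{S}_c\in\mathbb{R}$ for which $u=T^-[u]-\overline{S}_c$ has a continuous $1$-periodic solution $u$; any such solution is called a discrete weak K.A.M. solution for $f$ at cohomology class $c$. For such $u_c$, $\Sigma_+(x)$ denotes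 the (unique) maximizer of $y\mapsto u_c(y)-S_c(x,y)$ over $\mathbb{R}$, and $\operatorname{Graph}(\Sigma_+)=\{(x,\Sigma_+(x)):x\in\mathbb{R}\}$. For continuous $u:\mathbb{R}\to\mathbb{R}$, $\nabla^+u(x)=\{p\in\mathbb{R}:\limsup_{y\to x}\frac{u(y)-u(x)-p(y-x)}{|y-x|}\le0\}$. Then $\operatorname{Graph}(c+\nabla^+u_c)=\{(x,c+p):x\in\mathbb{R},\ p\in\nabla^+u_c(x)\}$ and $\operatorname{Graph}(c+dT^+[u_c])=\{(x,c+dT^+[u_c](x)): T^+[u_c]\text{ differentiable at }x\}$. A subset $M\subset\mathbb{R}^2$ is a Lipschitz submanifold if, for some $k$, every point of $M$ has an open neighbourhood $U$ in $\mathbb{R}^2$ and a bi-Lipschitz homeomorphism of $U$ onto an open subset $V$ of $\mathbb{R}^2$ carrying $M\cap U$ onto the intersection of $V$ with a $k$-dimensional linear subspace. *)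

theory Defs
  imports "HOL-Analysis.Analysis"
begin

section \<open>The annulus\<close>

quotient_type circle = real / "\<lambda>x y :: real. x - y \<in> \<int>"
proof (rule equivpI)
  show "reflp (\<lambda>x y :: real. x - y \<in> \<int>)"
    by (simp add: reflp_def)
  show "symp (\<lambda>x y :: real. x - y \<in> \<int>)"
    by (metis (lifting) Ints_minus minus_diff_eq sympI)
  show "transp (\<lambda>x y :: real. x - y \<in> \<int>)"
  proof (rule transpI)
    fix x y z :: real
    assume "x - y \<in> \<int>" "y - z \<in> \<int>"
    then have "(x - y) + (y - z) \<in> \<int>" by (rule Ints_add)
    then show "x - z \<in> \<int>" by simp
  qed
qed

instantiation circle :: topological_space
begin

definition open_circle :: "circle set \<Rightarrow> bool" where
  "open_circle U \<longleftrightarrow> open (abs_circle -` U)"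

instance
proof
  show "open (UNIV :: circle set)"
    by (simp add: open_circle_def)
  show "open (U \<inter> V)" if "open U" "open V" for U V :: "circle set"
    using that by (simp add: open_circle_def open_Int)
  show "open (\<Union> K)" if "\<forall>U\<in>K. open U" for K :: "circle set set"
    using that by (auto simp: open_circle_def vimage_Union)
qed

end

type_synonym annulus = "circle \<times> real"

definition covering :: "real \<times> real \<Rightarrow> annulus" where
  "covering z = (abs_circle (fst z), snd z)"

definition is_lift :: "(real \<times> real \<Rightarrow> real \<times> real) \<Rightarrow> (annulus \<Rightarrow> annulus) \<Rightarrow> bool" where
  "is_lift F f \<longleftrightarrow> continuous_on UNIV F \<and> (\<forall>z. covering (F z) = f (covering z))"

definition C1_on :: "'a::real_normed_vector set \<Rightarrow> ('a \<Rightarrow> 'b::real_normed_vector) \<Rightarrow> bool" where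
  "C1_on U g \<longleftrightarrow>
     (\<exists>g' :: 'a \<Rightarrow> 'a \<Rightarrow>\<^sub>L 'b.
        (\<forall>z\<in>U. (g has_derivative blinfun_apply (g' z)) (at z)) \<and> continuous_on U g')"

definition C2_on :: "'a::real_normed_vector set \<Rightarrow> ('a \<Rightarrow> 'b::real_normed_vector) \<Rightarrow> bool" where
  "C2_on U g \<longleftrightarrow>
     (\<exists>g' :: 'a \<Rightarrow> 'a \<Rightarrow>\<^sub>L 'b.
        (\<forall>z\<in>U. (g has_derivative blinfun_apply (g' z)) (at z)) \<and> C1_on U g')"

text \<open>The charts of the annulus are the local inverses of the covering map, so a map of the
  annulus is C1 iff in these charts, that is, after local lifting, it is C1.\<close>

definition annulus_C1 :: "(annulus \<Rightarrow> annulus) \<Rightarrow> bool" where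
  "annulus_C1 f \<longleftrightarrow>
     (\<forall>z. \<exists>U G. open U \<and> z \<in> U \<and> C1_on U G \<and> (\<forall>w\<in>U. covering (G w) = f (covering w)))"

definition annulus_C1_diffeo :: "(annulus \<Rightarrow> annulus) \<Rightarrow> bool" where
  "annulus_C1_diffeo f \<longleftrightarrow> bij f \<and> annulus_C1 f \<and> annulus_C1 (inv f)"

definition isotopic_to_id :: "(annulus \<Rightarrow> annulus) \<Rightarrow> bool" where
  "isotopic_to_id f \<longleftrightarrow>
     homotopic_with (homeomorphic_map euclidean euclidean) euclidean euclidean id f"


section \<open>Twist maps\<close>

text \<open>With \<open>F (x, p) = (y, p')\<close>, the form \<open>p' d\<theta>' - p d\<theta>\<close> pulls back to \<open>p' dy - p dx\<close> on the
  plane; it is exact if it is the differential of a function \<open>h\<close> which is defined on the annulus,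
  i.e. of a function on the plane which is 1-periodic in \<open>x\<close>. Such an \<open>h\<close> is automatically C1,
  as the form is continuous. A C1 map of the annulus has a lift, and the condition does not
  depend on the choice of the lift.\<close>

definition exact_symplectic :: "(annulus \<Rightarrow> annulus) \<Rightarrow> bool" where
  "exact_symplectic f \<longleftrightarrow>
     (\<forall>F. is_lift F f \<longrightarrow>
       (\<exists>h :: annulus \<Rightarrow> real. \<forall>x p.
          ((\<lambda>z. h (covering z)) has_derivative
             (\<lambda>v. snd (F (x, p)) * fst (frechet_derivative F (at (x, p)) v) - p * fst v))
          (at (x, p))))"

definition twist_map :: "(annulus \<Rightarrow> annulus) \<Rightarrow> bool" where
  "twist_map f \<longleftrightarrow>
     annulus_C1_diffeo f \<and> isotopic_to_id f \<and> exact_symplectic f \<and>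
     (\<forall>F. is_lift F f \<longrightarrow>
       (\<exists>\<epsilon>>0. \<forall>x p. 0 < deriv (\<lambda>q. fst (F (x, q))) p \<and>
                    deriv (\<lambda>q. fst (F (x, q))) p < 1 / \<epsilon>))"

definition partial1 :: "(real \<times> real \<Rightarrow> real) \<Rightarrow> real \<times> real \<Rightarrow> real" where
  "partial1 S = (\<lambda>(x, y). deriv (\<lambda>s. S (s, y)) x)"

definition partial2 :: "(real \<times> real \<Rightarrow> real) \<Rightarrow> real \<times> real \<Rightarrow> real" where
  "partial2 S = (\<lambda>(x, y). deriv (\<lambda>t. S (x, t)) y)"

definition generating_function ::
    "(real \<times> real \<Rightarrow> real \<times> real) \<Rightarrow> (real \<times> real \<Rightarrow> real) \<Rightarrow> bool" where
  "generating_function F S \<longleftrightarrow>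
     C2_on UNIV S \<and>
     (\<forall>x y. S (x + 1, y + 1) = S (x, y)) \<and>
     (\<exists>\<epsilon>>0. \<forall>x y. partial1 (partial2 S) (x, y) < - \<epsilon>) \<and>
     (\<forall>x p y p'. F (x, p) = (y, p') \<longleftrightarrow> p = - partial1 S (x, y) \<and> p' = partial2 S (x, y))"


section \<open>Discrete weak K.A.M. solutions\<close>

definition S_c :: "(real \<times> real \<Rightarrow> real) \<Rightarrow> real \<Rightarrow> real \<times> real \<Rightarrow> real" where
  "S_c S c = (\<lambda>(x, y). S (x, y) + c * (x - y))"

text \<open>For continuous 1-periodic \<open>u\<close> the infimum and supremum below are over sets bounded from
  below, respectively above, since \<open>S_c\<close> is coercive in \<open>x - y\<close>.\<close>

definition T_minus :: "(real \<times> real \<Rightarrow> real) \<Rightarrow> real \<Rightarrow> (real \<Rightarrow> real) \<Rightarrow> real \<Rightarrow> real" where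
  "T_minus S c u x = (INF y. u y + S_c S c (y, x))"

definition T_plus :: "(real \<times> real \<Rightarrow> real) \<Rightarrow> real \<Rightarrow> (real \<Rightarrow> real) \<Rightarrow> real \<Rightarrow> real" where
  "T_plus S c u x = (SUP y. u y - S_c S c (x, y))"

definition weak_KAM_eq ::
    "(real \<times> real \<Rightarrow> real) \<Rightarrow> real \<Rightarrow> real \<Rightarrow> (real \<Rightarrow> real) \<Rightarrow> bool" where
  "weak_KAM_eq S c k u \<longleftrightarrow>
     continuous_on UNIV u \<and> (\<forall>x. u (x + 1) = u x) \<and> (\<forall>x. u x = T_minus S c u x - k)"

definition S_bar :: "(real \<times> real \<Rightarrow> real) \<Rightarrow> real \<Rightarrow> real" where
  "S_bar S c = (THE k. \<exists>u. weak_KAM_eq S c k u)"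

definition weak_KAM_solution ::
    "(real \<times> real \<Rightarrow> real) \<Rightarrow> real \<Rightarrow> (real \<Rightarrow> real) \<Rightarrow> bool" where
  "weak_KAM_solution S c u \<longleftrightarrow> weak_KAM_eq S c (S_bar S c) u"

definition Sigma_plus :: "(real \<times> real \<Rightarrow> real) \<Rightarrow> real \<Rightarrow> (real \<Rightarrow> real) \<Rightarrow> real \<Rightarrow> real" where
  "Sigma_plus S c u x = (THE y. \<forall>z. u z - S_c S c (x, z) \<le> u y - S_c S c (x, y))"

definition superdifferential :: "(real \<Rightarrow> real) \<Rightarrow> real \<Rightarrow> real set" where
  "superdifferential u x =
     {p. Limsup (at x) (\<lambda>y. ereal ((u y - u x - p * (y - x)) / \<bar>y - x\<bar>)) \<le> 0}"

definition graph_Sigma_plus ::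
    "(real \<times> real \<Rightarrow> real) \<Rightarrow> real \<Rightarrow> (real \<Rightarrow> real) \<Rightarrow> (real \<times> real) set" where
  "graph_Sigma_plus S c u = {(x, Sigma_plus S c u x) | x. True}"

definition graph_dT_plus ::
    "(real \<times> real \<Rightarrow> real) \<Rightarrow> real \<Rightarrow> (real \<Rightarrow> real) \<Rightarrow> (real \<times> real) set" where
  "graph_dT_plus S c u =
     {(x, c + deriv (T_plus S c u) x) | x. T_plus S c u differentiable (at x)}"

definition graph_superdifferential :: "real \<Rightarrow> (real \<Rightarrow> real) \<Rightarrow> (real \<times> real) set" where
  "graph_superdifferential c u = {(x, c + p) | x p. p \<in> superdifferential u x}"

definition Gamma_minus :: "(real \<times> real \<Rightarrow> real) \<Rightarrow> real \<times> real \<Rightarrow> real \<times> real" where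
  "Gamma_minus S = (\<lambda>(x, y). (x, - partial1 S (x, y)))"

definition Gamma_plus :: "(real \<times> real \<Rightarrow> real) \<Rightarrow> real \<times> real \<Rightarrow> real \<times> real" where
  "Gamma_plus S = (\<lambda>(x, y). (y, partial2 S (x, y)))"


section \<open>Lipschitz submanifolds\<close>

definition lipschitz_submanifold :: "'a::euclidean_space set \<Rightarrow> bool" where
  "lipschitz_submanifold M \<longleftrightarrow>
     (\<exists>k. \<forall>z\<in>M. \<exists>U V W g h L.
        open U \<and> z \<in> U \<and> open (V :: 'a set) \<and>
        homeomorphism U V g h \<and> L-lipschitz_on U g \<and> L-lipschitz_on V h \<and>
        subspace W \<and> dim W = k \<and> g ` (M \<inter> U) = V \<inter> W)"

end

theory Submission
  imports Defs "HOL-Library.Periodic_Fun"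
begin

text \<open>The graph of \<open>\<Sigma>\<^sub>+\<close> carries all three sets: the other two graphs are its images under \<open>\<Gamma>\<^sup>-\<close>
(\<open>graph_dT_plus_eq\<close>) and \<open>\<Gamma>\<^sup>+\<close> (\<open>graph_superdifferential_eq\<close>). By the twist condition \<open>\<Gamma>\<^sup>-\<close> and
\<open>\<Gamma>\<^sup>+\<close> are homeomorphisms of the plane that are Lipschitz on bounded sets, with inverses of the same
kind, and the graph of \<open>\<Sigma>\<^sub>+\<close> becomes a straight line under such a homeomorphism because \<open>\<Sigma>\<^sub>+\<close> is
monotone and continuous (\<open>lipeomorphism_monotone_graph\<close>). The diagram commutes by the very
definition of a generating function.

What remains is to understand \<open>\<Sigma>\<^sub>+\<close>. Write \<open>k\<close> for the constant of the weak K.A.M. equation and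
call \<open>w\<close> a predecessor of \<open>y\<close> if \<open>u(y) = u(w) + S_c(w, y) - k\<close>, i.e. if \<open>w\<close> attains the infimum
defining \<open>u(y)\<close>. Each \<open>y\<close> has a predecessor, by coercivity of \<open>S\<close>; predecessors depend monotonically
on \<open>y\<close>, and distinct points have no common predecessor. The central fact is that
\<open>y\<close> maximises \<open>u - S_c(x, \<cdot>)\<close> if and only if \<open>x\<close> lies between two predecessors of \<open>y\<close>
(\<open>optimal_iff_between\<close>), and that this is also equivalent to \<open>\<partial>\<^sub>2S(x, y) - c\<close> being a
superdifferential of \<open>u\<close> at \<open>y\<close>. One direction compares barriers by the twist condition
(\<open>optimal_between\<close>), the other takes one-sided limits of predecessors
(\<open>superdifferential_one_sided\<close>). Existence, uniqueness, monotonicity and continuity of \<open>\<Sigma>\<^sub>+\<close>, the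
derivative of \<open>T\<^sup>+[u]\<close> and the description of the graph of \<open>c + \<nabla>\<^sup>+u\<close> all follow from it.\<close>

section \<open>Lipeomorphisms and Lipschitz submanifolds\<close>

text \<open>On a Euclidean space this is the usual local Lipschitz condition. Quantifying over bounded sets
rather than over neighbourhoods makes the class closed under composition with no choice of
neighbourhoods, because the image of a bounded set is bounded again.\<close>

definition boundedly_lipschitz :: "('a::metric_space \<Rightarrow> 'b::metric_space) \<Rightarrow> bool" where
  "boundedly_lipschitz f \<longleftrightarrow> (\<forall>X. bounded X \<longrightarrow> (\<exists>L. L-lipschitz_on X f))"

lemma boundedly_lipschitzE:
  assumes "boundedly_lipschitz f" "bounded X"
  obtains L where "L \<ge> 0" "L-lipschitz_on X f"
  using assms lipschitz_on_nonneg unfolding boundedly_lipschitz_def by blast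

lemma boundedly_lipschitz_bounded_image:
  assumes "boundedly_lipschitz f" "bounded X"
  shows "bounded (f ` X)"
proof -
  obtain L where L: "L \<ge> 0" "L-lipschitz_on X f"
    using boundedly_lipschitzE[OF assms] by metis
  obtain x r where r: "\<And>y. y \<in> X \<Longrightarrow> dist x y \<le> r" and "x \<in> X \<or> X = {}"
    using assms(2) by (metis bounded_any_center bounded_def ex_in_conv)
  then have "dist (f x) (f y) \<le> L * r" if "y \<in> X" for y
    using that L r[OF that] by (metis empty_iff lipschitz_onD mult_left_mono order_trans)
  then show ?thesis
    unfolding bounded_def by blast
qed

lemma boundedly_lipschitz_compose:
  assumes "boundedly_lipschitz f" "boundedly_lipschitz g"
  shows "boundedly_lipschitz (\<lambda>x. g (f x))"
  unfolding boundedly_lipschitz_def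
proof (intro allI impI)
  fix X :: "'a set" assume X: "bounded X"
  obtain L where L: "L-lipschitz_on X f"
    using boundedly_lipschitzE[OF assms(1) X] by metis
  obtain K where K: "K-lipschitz_on (f ` X) g"
    using boundedly_lipschitzE[OF assms(2) boundedly_lipschitz_bounded_image[OF assms(1) X]] by metis
  show "\<exists>L. L-lipschitz_on X (\<lambda>x. g (f x))"
    using lipschitz_on_compose2[OF L K] by blast
qed

lemma boundedly_lipschitz_Pair:
  assumes "boundedly_lipschitz f" "boundedly_lipschitz g"
  shows "boundedly_lipschitz (\<lambda>x. (f x, g x))"
  using assms unfolding boundedly_lipschitz_def by (fast intro: lipschitz_on_Pair)

lemma boundedly_lipschitz_add:
  fixes f g :: "'a::metric_space \<Rightarrow> 'b::real_normed_vector"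
  assumes "boundedly_lipschitz f" "boundedly_lipschitz g"
  shows "boundedly_lipschitz (\<lambda>x. f x + g x)"
  using assms unfolding boundedly_lipschitz_def by (fast intro: lipschitz_on_add)

lemma boundedly_lipschitz_minus:
  fixes f :: "'a::metric_space \<Rightarrow> 'b::real_normed_vector"
  assumes "boundedly_lipschitz f"
  shows "boundedly_lipschitz (\<lambda>x. - f x)"
  using assms unfolding boundedly_lipschitz_def by (fast intro: lipschitz_on_minus)

lemma boundedly_lipschitz_bounded_linear:
  assumes "bounded_linear f"
  shows "boundedly_lipschitz f"
  unfolding boundedly_lipschitz_def
  by (metis bounded_linear.lipschitz_boundE[OF assms])

lemma boundedly_lipschitz_continuous:
  assumes "boundedly_lipschitz f"
  shows "continuous_on X f"
proof -
  have "isCont f x" for x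
  proof -
    obtain L where "L-lipschitz_on (ball x 1) f"
      using boundedly_lipschitzE[OF assms bounded_ball] by metis
    then show ?thesis
      using lipschitz_on_continuous_on[of L "ball x 1" f]
      by (simp add: continuous_on_eq_continuous_at)
  qed
  then show ?thesis by (simp add: continuous_at_imp_continuous_on)
qed

lemma C1_imp_boundedly_lipschitz:
  fixes f :: "'a::euclidean_space \<Rightarrow> 'b::real_normed_vector"
  assumes "C1_on UNIV f"
  shows "boundedly_lipschitz f"
  unfolding boundedly_lipschitz_def
proof (intro allI impI)
  fix X :: "'a set" assume "bounded X"
  then obtain r where r: "X \<subseteq> cball 0 r"
    by (auto simp: bounded_iff subset_iff)
  obtain f' where d: "\<And>z. (f has_derivative blinfun_apply (f' z)) (at z)"
    and c: "continuous_on UNIV f'"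
    using assms unfolding C1_on_def by auto
  have "compact (f' ` cball 0 r)"
    by (intro compact_continuous_image compact_cball continuous_on_subset[OF c]) auto
  then obtain B where B: "\<And>z. z \<in> cball 0 r \<Longrightarrow> norm (f' z) \<le> B"
    using compact_imp_bounded by (fastforce simp: bounded_iff)
  have "norm (f x - f y) \<le> B * norm (x - y)" if "x \<in> cball 0 r" "y \<in> cball 0 r" for x y
    by (rule differentiable_bound[of "cball 0 r" f "\<lambda>z. blinfun_apply (f' z)"])
       (use B d that in \<open>auto simp: norm_blinfun.rep_eq[symmetric] intro: has_derivative_at_withinI\<close>)
  then have "\<bar>B\<bar>-lipschitz_on X f"
    using r by (intro lipschitz_onI) 
      (auto simp: dist_norm subset_iff intro: order_trans[OF _ mult_right_mono[OF abs_ge_self]])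
  then show "\<exists>L. L-lipschitz_on X f" ..
qed

definition lipeomorphism ::
    "('a::metric_space \<Rightarrow> 'b::metric_space) \<Rightarrow> ('b \<Rightarrow> 'a) \<Rightarrow> bool" where
  "lipeomorphism \<Phi> \<Psi> \<longleftrightarrow> boundedly_lipschitz \<Phi> \<and> boundedly_lipschitz \<Psi> \<and>
     (\<forall>z. \<Psi> (\<Phi> z) = z) \<and> (\<forall>w. \<Phi> (\<Psi> w) = w)"

lemma lipeomorphism_compose:
  assumes "lipeomorphism \<Phi> \<Psi>" "lipeomorphism \<Phi>' \<Psi>'"
  shows "lipeomorphism (\<lambda>z. \<Phi>' (\<Phi> z)) (\<lambda>w. \<Psi> (\<Psi>' w))"
  using assms by (simp add: lipeomorphism_def boundedly_lipschitz_compose)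

text \<open>The inverse of the lipeomorphism is a chart around every point at once: it only has to be
restricted to a unit ball, where the Lipschitz constants become uniform.\<close>

lemma lipschitz_submanifold_lipeomorphic_image:
  fixes \<Phi> :: "'a::euclidean_space \<Rightarrow> 'a"
  assumes \<Phi>: "lipeomorphism \<Phi> \<Psi>" and W: "subspace W"
  shows "lipschitz_submanifold (\<Phi> ` W)"
  unfolding lipschitz_submanifold_def
proof (rule exI[of _ "dim W"], rule ballI)
  fix z assume "z \<in> \<Phi> ` W"
  have bl: "boundedly_lipschitz \<Phi>" "boundedly_lipschitz \<Psi>"
    and inv: "\<And>z. \<Psi> (\<Phi> z) = z" "\<And>w. \<Phi> (\<Psi> w) = w"
    using \<Phi> by (auto simp: lipeomorphism_def)
  let ?U = "ball z 1" and ?V = "\<Phi> -` ball z 1"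
  have V: "\<Psi> ` ?U = ?V"
  proof (intro equalityI subsetI)
    show "w \<in> \<Psi> ` ?U" if "w \<in> ?V" for w
      using that by (intro image_eqI[of w \<Psi> "\<Phi> w"]) (auto simp: inv(1))
  qed (auto simp: inv(2))
  have "bounded ?V"
    unfolding V[symmetric] by (intro boundedly_lipschitz_bounded_image bl bounded_ball)
  then obtain K where K: "K-lipschitz_on ?V \<Phi>"
    using boundedly_lipschitzE[OF bl(1)] by metis
  obtain L where L: "L-lipschitz_on ?U \<Psi>"
    using boundedly_lipschitzE[OF bl(2) bounded_ball] by metis
  have "open ?U \<and> z \<in> ?U \<and> open ?V \<and> homeomorphism ?U ?V \<Psi> \<Phi> \<and>
      (max L K)-lipschitz_on ?U \<Psi> \<and> (max L K)-lipschitz_on ?V \<Phi> \<and>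
      subspace W \<and> dim W = dim W \<and> \<Psi> ` (\<Phi> ` W \<inter> ?U) = ?V \<inter> W"
  proof (intro conjI)
    show "open ?V"
      by (rule open_vimage[OF open_ball boundedly_lipschitz_continuous[OF bl(1)]])
    show "homeomorphism ?U ?V \<Psi> \<Phi>"
      by (rule homeomorphismI) (use inv in \<open>auto intro: boundedly_lipschitz_continuous bl\<close>)
    have "\<Psi> ` (\<Phi> ` W \<inter> ?U) = \<Psi> ` \<Phi> ` W \<inter> \<Psi> ` ?U"
      by (intro image_Int inj_on_inverseI[of _ \<Phi>] inv)
    also have "\<Psi> ` \<Phi> ` W = W"
      by (simp add: image_image inv)
    finally show "\<Psi> ` (\<Phi> ` W \<inter> ?U) = ?V \<inter> W"
      unfolding V by (simp only: Int_commute)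
  qed (use W L K in \<open>auto intro: lipschitz_on_mono\<close>)
  then show "\<exists>U V W' g h L. open U \<and> z \<in> U \<and> open (V :: 'a set) \<and> homeomorphism U V g h \<and>
      L-lipschitz_on U g \<and> L-lipschitz_on V h \<and>
      subspace W' \<and> dim W' = dim W \<and> g ` (\<Phi> ` W \<inter> U) = V \<inter> W'"
    by (intro exI)
qed

text \<open>A map preserving the vertical lines and expanding each of them by at least \<open>\<epsilon>\<close> is onto by the
intermediate value theorem. Its inverse is locally Lipschitz also in the horizontal direction,
since the expansion bounds the vertical distance of two points
by the distance of their images plus the variation of \<open>q\<close> along a horizontal segment. The twist
condition says that \<open>\<Gamma>\<^sup>-\<close> and, after exchanging the coordinates, \<open>\<Gamma>\<^sup>+\<close> are of this kind.\<close>

lemma lipeomorphism_fibre_map: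
  fixes q :: "real \<times> real \<Rightarrow> real"
  assumes q: "boundedly_lipschitz q" and e: "\<epsilon> > 0"
    and expand: "\<And>a b b'. b \<le> b' \<Longrightarrow> \<epsilon> * (b' - b) \<le> q (a, b') - q (a, b)"
  shows "\<exists>\<Psi>. lipeomorphism (\<lambda>z. (fst z, q z)) \<Psi>"
proof -
  have expand_abs: "\<epsilon> * \<bar>b' - b\<bar> \<le> \<bar>q (a, b') - q (a, b)\<bar>" for a b b'
    using expand[of b b' a] expand[of b' b a] by (cases "b \<le> b'") auto
  have "\<exists>b. q (a, b) = p" for a p :: real
  proof -
    define t where "t = \<bar>p - q (a, 0)\<bar> / \<epsilon>"
    have t: "t \<ge> 0" "\<epsilon> * t = \<bar>p - q (a, 0)\<bar>"
      using e by (auto simp: t_def)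
    have "continuous_on {-t..t} (\<lambda>b. q (a, b))"
      by (rule continuous_on_compose2[OF boundedly_lipschitz_continuous[OF q, of UNIV]])
         (auto intro!: continuous_intros)
    moreover have "q (a, -t) \<le> p" "p \<le> q (a, t)"
      using expand[of "-t" 0 a] expand[of 0 t a] t by auto
    ultimately show ?thesis
      using IVT'[of "\<lambda>b. q (a, b)" "-t" p t] t by auto
  qed
  then obtain r where r: "\<And>a p. q (a, r a p) = p"
    by metis
  have inv: "r a (q (a, b)) = b" for a b
    using expand_abs[of "r a (q (a, b))" b a] e by (simp add: r mult_le_0_iff)
  define \<Psi> where "\<Psi> = (\<lambda>w. (fst w, r (fst w) (snd w)))"
  have "\<exists>L. L-lipschitz_on X \<Psi>" if X: "bounded X" for X
  proof -
    have bd: "bounded (fst ` X)" "bounded (snd ` X)"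
      using X by (auto intro: bounded_fst bounded_snd)
    have "bounded ((\<lambda>a. q (a, 0)) ` fst ` X)"
      by (intro boundedly_lipschitz_bounded_image boundedly_lipschitz_compose[OF _ q] bd
          boundedly_lipschitz_bounded_linear bounded_linear_Pair bounded_linear_ident bounded_linear_zero)
    then obtain A where A: "\<And>w. w \<in> X \<Longrightarrow> \<bar>q (fst w, 0)\<bar> \<le> A"
      by (auto simp: bounded_iff)
    obtain P where P: "\<And>w. w \<in> X \<Longrightarrow> \<bar>snd w\<bar> \<le> P"
      using bd(2) by (auto simp: bounded_iff)
    have "\<bar>r (fst w) (snd w)\<bar> \<le> (P + A) / \<epsilon>" if "w \<in> X" for w
      using expand_abs[of "r (fst w) (snd w)" 0 "fst w"] A[OF that] P[OF that] e
      by (simp add: r field_simps)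
    then have "bounded ((\<lambda>w. r (fst w) (snd w)) ` X)"
      unfolding bounded_iff by (metis (no_types, lifting) imageE real_norm_def)
    then have "bounded (fst ` X \<times> (\<lambda>w. r (fst w) (snd w)) ` X)"
      using bd by (intro bounded_Times)
    then obtain K where K0: "K \<ge> 0"
      and K: "K-lipschitz_on (fst ` X \<times> (\<lambda>w. r (fst w) (snd w)) ` X) q"
      using boundedly_lipschitzE[OF q] by metis
    have "dist (\<Psi> w) (\<Psi> w') \<le> (1 + (1 + K) / \<epsilon>) * dist w w'" if w: "w \<in> X" "w' \<in> X" for w w'
    proof -
      let ?b = "r (fst w) (snd w)" and ?b' = "r (fst w') (snd w')"
      \<comment> \<open>The point with the first coordinate of \<open>\<Psi> w\<close> and the second one of \<open>\<Psi> w'\<close> separates the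
        change of the fibre from the motion inside a fibre; it is why the Lipschitz constant \<open>K\<close>
        is taken on a product set.\<close>
      have "\<epsilon> * \<bar>?b - ?b'\<bar> \<le> \<bar>q (fst w, ?b) - q (fst w, ?b')\<bar>"
        by (rule expand_abs)
      also have "\<dots> \<le> \<bar>snd w - snd w'\<bar> + \<bar>q (fst w, ?b') - q (fst w', ?b')\<bar>"
        by (simp add: r)
      also have "\<bar>q (fst w, ?b') - q (fst w', ?b')\<bar> \<le> K * dist (fst w, ?b') (fst w', ?b')"
        unfolding dist_real_def[symmetric] by (rule lipschitz_onD[OF K]) (use w in auto)
      also have "\<dots> \<le> K * dist w w'"
        using K0 dist_fst_le[of w w'] by (simp add: dist_Pair_Pair mult_left_mono)
      also have "\<bar>snd w - snd w'\<bar> \<le> dist w w'"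
        using dist_snd_le[of w w'] by (simp add: dist_real_def)
      finally have "\<bar>?b - ?b'\<bar> \<le> (1 + K) / \<epsilon> * dist w w'"
        using e by (simp add: field_simps)
      moreover have "dist (\<Psi> w) (\<Psi> w') \<le> dist (fst w) (fst w') + \<bar>?b - ?b'\<bar>"
        by (simp add: \<Psi>_def dist_Pair_Pair dist_real_def sqrt_sum_squares_le_sum_abs
            order_trans[OF sqrt_sum_squares_le_sum_abs])
      ultimately show ?thesis
        using dist_fst_le[of w w'] by (simp add: algebra_simps)
    qed
    moreover have "0 \<le> 1 + (1 + K) / \<epsilon>"
      using K0 e by simp
    ultimately show ?thesis
      by (blast intro: lipschitz_onI)
  qed
  then have "boundedly_lipschitz \<Psi>"
    by (simp add: boundedly_lipschitz_def)
  moreover have "boundedly_lipschitz (\<lambda>z. (fst z, q z))"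
    by (intro boundedly_lipschitz_Pair boundedly_lipschitz_bounded_linear bounded_linear_fst q)
  ultimately show ?thesis
    by (intro exI[of _ \<Psi>]) (simp add: lipeomorphism_def \<Psi>_def r inv)
qed

text \<open>A continuous monotone function need not be Lipschitz, but its graph is a Lipschitz curve:
parametrised by \<open>s = x + \<sigma> x\<close>, the coordinate \<open>x = \<xi> s\<close> is a
1-Lipschitz function of \<open>s\<close>. Shearing by \<open>\<xi>\<close> straightens the graph to a line.\<close>

lemma lipeomorphism_monotone_graph:
  fixes \<sigma> :: "real \<Rightarrow> real"
  assumes mono: "mono \<sigma>" and cont: "continuous_on UNIV \<sigma>"
  shows "\<exists>\<Phi> \<Psi>. lipeomorphism \<Phi> \<Psi> \<and> range (\<lambda>x. (x, \<sigma> x)) = \<Phi> ` ((UNIV :: real set) \<times> {0::real})"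
proof -
  have surj: "\<exists>x. x + \<sigma> x = s" for s
  proof -
    define t where "t = \<bar>s - \<sigma> 0\<bar>"
    have "-t + \<sigma> (-t) \<le> s" "s \<le> t + \<sigma> t"
      using monoD[OF mono, of "-t" 0] monoD[OF mono, of 0 t] by (auto simp: t_def)
    moreover have "continuous_on {-t..t} (\<lambda>x. x + \<sigma> x)"
      by (intro continuous_intros continuous_on_subset[OF cont]) auto
    ultimately show ?thesis
      using IVT'[of "\<lambda>x. x + \<sigma> x" "-t" s t] by (auto simp: t_def)
  qed
  then obtain \<xi> where \<xi>: "\<And>s. \<xi> s + \<sigma> (\<xi> s) = s"
    by metis
  have expand: "\<bar>x - x'\<bar> \<le> \<bar>(x + \<sigma> x) - (x' + \<sigma> x')\<bar>" for x x'
    using monoD[OF mono, of x x'] monoD[OF mono, of x' x] by linarith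
  have inv: "\<xi> (x + \<sigma> x) = x" for x
    using expand[of "\<xi> (x + \<sigma> x)" x] by (simp add: \<xi>)
  have "1-lipschitz_on X \<xi>" for X
    using expand[of "\<xi> s" "\<xi> s'" for s s'] by (intro lipschitz_onI) (auto simp: dist_real_def \<xi>)
  then have bl: "boundedly_lipschitz \<xi>"
    by (auto simp: boundedly_lipschitz_def)
  define \<Phi> :: "real \<times> real \<Rightarrow> real \<times> real" where
    "\<Phi> = (\<lambda>z. (snd z + \<xi> (fst z), fst z + - (snd z + \<xi> (fst z))))"
  define \<Psi> :: "real \<times> real \<Rightarrow> real \<times> real" where
    "\<Psi> = (\<lambda>w. (fst w + snd w, fst w + - \<xi> (fst w + snd w)))"
  have "boundedly_lipschitz \<Phi>" "boundedly_lipschitz \<Psi>"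
    unfolding \<Phi>_def \<Psi>_def
    by (intro boundedly_lipschitz_Pair boundedly_lipschitz_add boundedly_lipschitz_minus
        boundedly_lipschitz_compose[OF _ bl] boundedly_lipschitz_bounded_linear
        bounded_linear_fst bounded_linear_snd bounded_linear_add)+
  then have "lipeomorphism \<Phi> \<Psi>"
    by (simp add: lipeomorphism_def \<Phi>_def \<Psi>_def)
  moreover have "range (\<lambda>x. (x, \<sigma> x)) = \<Phi> ` (UNIV \<times> {0})"
  proof -
    have "\<Phi> (s, 0) = (\<xi> s, \<sigma> (\<xi> s))" for s
      using \<xi>[of s] by (auto simp: \<Phi>_def)
    then have "\<Phi> ` (UNIV \<times> {0}) = (\<lambda>s. (\<xi> s, \<sigma> (\<xi> s))) ` UNIV"
      by (auto simp: image_iff)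
    also have "\<dots> = range (\<lambda>x. (x, \<sigma> x))"
      using inv by (auto simp: image_iff) (metis inv)
    finally show ?thesis by simp
  qed
  ultimately show ?thesis by blast
qed

section \<open>Generating functions\<close>

lemma continuous_periodic_imp_bounded:
  fixes f :: "real \<Rightarrow> real"
  assumes cont: "continuous_on UNIV f" and per: "\<And>x. f (x + 1) = f x"
  shows "\<exists>B. \<forall>x. \<bar>f x\<bar> \<le> B"
proof -
  interpret periodic_fun_simple' f
    by unfold_locales (rule per)
  have "compact (f ` {0..1})"
    by (intro compact_continuous_image continuous_on_subset[OF cont]) auto
  then obtain B where B: "\<And>x. 0 \<le> x \<Longrightarrow> x \<le> 1 \<Longrightarrow> \<bar>f x\<bar> \<le> B"
    using compact_imp_bounded by (fastforce simp: bounded_iff)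
  have "\<bar>f x\<bar> \<le> B" for x
    using B[of "x - of_int \<lfloor>x\<rfloor>"] by (simp add: minus_of_int) linarith
  then show ?thesis by blast
qed

text \<open>The constant \<open>\<epsilon>\<close> is a parameter because it quantifies both the growth of \<open>S\<close> away from the diagonal
and the rate at which \<open>\<Gamma>\<^sup>-\<close> and \<open>\<Gamma>\<^sup>+\<close> expand the fibres.\<close>

locale generating =
  fixes S :: "real \<times> real \<Rightarrow> real" and \<epsilon> :: real
  assumes C2: "C2_on UNIV S"
    and periodic: "S (x + 1, y + 1) = S (x, y)"
    and eps_pos: "0 < \<epsilon>"
    and mixed_partial: "partial1 (partial2 S) (x, y) < - \<epsilon>"
begin

lemma partials:
  shows partial1_DERIV: "((\<lambda>s. S (s, y)) has_real_derivative partial1 S (x, y)) (at x)"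
    and partial2_DERIV: "((\<lambda>t. S (x, t)) has_real_derivative partial2 S (x, y)) (at y)"
    and partial1_boundedly_lipschitz: "boundedly_lipschitz (partial1 S)"
    and partial2_boundedly_lipschitz: "boundedly_lipschitz (partial2 S)"
    and mixed_partial_DERIV:
      "((\<lambda>s. partial2 S (s, y)) has_real_derivative partial1 (partial2 S) (x, y)) (at x)"
    and continuous: "continuous_on X S"
proof -
  obtain S' :: "real \<times> real \<Rightarrow> ((real \<times> real) \<Rightarrow>\<^sub>L real)" where
    S'_UNIV: "\<forall>z\<in>UNIV. (S has_derivative blinfun_apply (S' z)) (at z)" and C1: "C1_on UNIV S'"
    using C2 unfolding C2_on_def by (elim exE conjE)
  obtain S'' where S''_UNIV: "\<forall>z\<in>UNIV. (S' has_derivative blinfun_apply (S'' z)) (at z)"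
    using C1 unfolding C1_on_def by (elim exE conjE)
  have S': "(S has_derivative blinfun_apply (S' z)) (at z)" for z
    using S'_UNIV by (rule bspec) simp
  have S'': "(S' has_derivative blinfun_apply (S'' z)) (at z)" for z
    using S''_UNIV by (rule bspec) simp
  have d1: "((\<lambda>s. S (s, y)) has_real_derivative S' (x, y) (1, 0)) (at x)" for x y
  proof -
    have "((\<lambda>s. S (s, y)) has_derivative (\<lambda>h. S' (x, y) (h, 0))) (at x)"
      by (rule has_derivative_compose[OF _ S', of "\<lambda>s. (s, y)" "\<lambda>h. (h, 0)" x UNIV, simplified])
         (auto intro!: derivative_eq_intros)
    also have "(\<lambda>h. S' (x, y) (h, 0)) = (*) (S' (x, y) (1, 0))"
    proof
      show "S' (x, y) (h, 0) = S' (x, y) (1, 0) * h" for h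
        using blinfun.scaleR_right[of "S' (x, y)" h "(1, 0)"] by simp
    qed
    finally show ?thesis by (simp only: has_field_derivative_def)
  qed
  have d2: "((\<lambda>t. S (x, t)) has_real_derivative S' (x, y) (0, 1)) (at y)" for x y
  proof -
    have "((\<lambda>t. S (x, t)) has_derivative (\<lambda>h. S' (x, y) (0, h))) (at y)"
      by (rule has_derivative_compose[OF _ S', of "\<lambda>t. (x, t)" "\<lambda>h. (0, h)" y UNIV, simplified])
         (auto intro!: derivative_eq_intros)
    also have "(\<lambda>h. S' (x, y) (0, h)) = (*) (S' (x, y) (0, 1))"
    proof
      show "S' (x, y) (0, h) = S' (x, y) (0, 1) * h" for h
        using blinfun.scaleR_right[of "S' (x, y)" h "(0, 1)"] by simp
    qed
    finally show ?thesis by (simp only: has_field_derivative_def)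
  qed
  have p1: "partial1 S = (\<lambda>z. S' z (1, 0))"
    by (rule ext) (simp add: partial1_def split_beta DERIV_imp_deriv[OF d1])
  have p2: "partial2 S = (\<lambda>z. S' z (0, 1))"
    by (rule ext) (simp add: partial2_def split_beta DERIV_imp_deriv[OF d2])
  show "((\<lambda>s. S (s, y)) has_real_derivative partial1 S (x, y)) (at x)"
    "((\<lambda>t. S (x, t)) has_real_derivative partial2 S (x, y)) (at y)"
    using d1 d2 by (simp_all add: p1 p2)
  show "boundedly_lipschitz (partial1 S)" "boundedly_lipschitz (partial2 S)"
    unfolding p1 p2
    by (intro boundedly_lipschitz_compose[OF C1_imp_boundedly_lipschitz[OF C1]]
        boundedly_lipschitz_bounded_linear blinfun.bounded_linear_left)+
  have "((\<lambda>s. S' (s, y) (0, 1)) has_derivative (\<lambda>h. S'' (x, y) (h, 0) (0, 1))) (at x)"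
  proof -
    have "((\<lambda>s. S' (s, y)) has_derivative (\<lambda>h. S'' (x, y) (h, 0))) (at x)"
      by (rule has_derivative_compose[OF _ S'', of "\<lambda>s. (s, y)" "\<lambda>h. (h, 0)" x UNIV, simplified])
         (auto intro!: derivative_eq_intros)
    then show ?thesis
      by (rule bounded_linear.has_derivative[OF blinfun.bounded_linear_left])
  qed
  then have "(\<lambda>s. partial2 S (s, y)) differentiable (at x)"
    unfolding p2 differentiable_def by blast
  then show "((\<lambda>s. partial2 S (s, y)) has_real_derivative partial1 (partial2 S) (x, y)) (at x)"
    by (simp add: partial1_def DERIV_deriv_iff_real_differentiable)
  show "continuous_on X S"
    by (intro continuous_at_imp_continuous_on ballI has_derivative_continuous[OF S'])
qed

lemma continuous_partial1: "continuous_on X (partial1 S)"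
  and continuous_partial2: "continuous_on X (partial2 S)"
  by (intro boundedly_lipschitz_continuous partial1_boundedly_lipschitz
      partial2_boundedly_lipschitz)+

lemma partial2_twist:
  assumes "x \<le> x'"
  shows "partial2 S (x', y) - partial2 S (x, y) \<le> - \<epsilon> * (x' - x)"
proof -
  have "partial2 S (x', y) + \<epsilon> * x' \<le> partial2 S (x, y) + \<epsilon> * x"
  proof (rule DERIV_nonpos_imp_nonincreasing[OF assms])
    fix s
    have "((\<lambda>s. partial2 S (s, y) + \<epsilon> * s) has_real_derivative
        partial1 (partial2 S) (s, y) + \<epsilon>) (at s)"
      by (auto intro!: derivative_eq_intros mixed_partial_DERIV)
    then show "\<exists>D. ((\<lambda>s. partial2 S (s, y) + \<epsilon> * s) has_real_derivative D) (at s) \<and> D \<le> 0"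
      using mixed_partial[of s y] by force
  qed
  then show ?thesis by (simp add: algebra_simps)
qed

text \<open>The integrated form of the twist condition. Besides being what comparisons of actions need, it is
symmetric in the two variables, so that dividing by \<open>x' - x\<close> and passing to the limit turns the
assumption on \<open>\<partial>\<^sub>1\<partial>\<^sub>2S\<close> into the monotonicity of \<open>\<partial>\<^sub>1S\<close> in \<open>y\<close>.\<close>

lemma twist:
  assumes "x \<le> x'" "y \<le> y'"
  shows "S (x', y') - S (x', y) - S (x, y') + S (x, y) \<le> - \<epsilon> * (x' - x) * (y' - y)"
proof -
  have "S (x', y') - S (x, y') + \<epsilon> * (x' - x) * y' \<le> S (x', y) - S (x, y) + \<epsilon> * (x' - x) * y"
  proof (rule DERIV_nonpos_imp_nonincreasing[OF assms(2)])
    fix t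
    show "\<exists>D. ((\<lambda>t. S (x', t) - S (x, t) + \<epsilon> * (x' - x) * t) has_real_derivative D) (at t)
        \<and> D \<le> 0"
    proof (intro exI conjI)
      show "((\<lambda>t. S (x', t) - S (x, t) + \<epsilon> * (x' - x) * t) has_real_derivative
          partial2 S (x', t) - partial2 S (x, t) + \<epsilon> * (x' - x)) (at t)"
        by (rule DERIV_add[OF DERIV_diff[OF partial2_DERIV partial2_DERIV] DERIV_cmult_Id])
    qed (use partial2_twist[OF assms(1), of t] in simp)
  qed
  then show ?thesis by (simp add: algebra_simps)
qed

lemma strict_twist:
  assumes "x < x'" "y < y'"
  shows "S (x', y') + S (x, y) < S (x', y) + S (x, y')"
proof -
  have "0 < \<epsilon> * (x' - x) * (y' - y)"
    using assms eps_pos by simp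
  then show ?thesis
    using twist[of x x' y y'] assms by simp
qed

lemma partial1_twist:
  assumes "y \<le> y'"
  shows "partial1 S (x, y') - partial1 S (x, y) \<le> - \<epsilon> * (y' - y)"
proof -
  let ?g = "\<lambda>s. S (s, y) - S (s, y') - \<epsilon> * (y' - y) * s"
  have "mono_on UNIV ?g"
    using twist[OF _ assms] by (intro mono_onI) (simp add: algebra_simps)
  moreover have "(?g has_real_derivative partial1 S (x, y) - partial1 S (x, y') - \<epsilon> * (y' - y)) (at x)"
    by (auto intro!: derivative_eq_intros partial1_DERIV)
  ultimately have "partial1 S (x, y) - partial1 S (x, y') - \<epsilon> * (y' - y) \<ge> 0"
    by (rule mono_on_imp_deriv_nonneg) simp
  then show ?thesis by simp
qed

lemma partial1_inject: "partial1 S (x, y) = partial1 S (x, y') \<longleftrightarrow> y = y'"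
proof -
  have "y' \<le> y" if "partial1 S (x, y) = partial1 S (x, y')" for y y'
    using partial1_twist[of y y' x] that eps_pos by (cases "y \<le> y'") (auto simp: mult_le_0_iff)
  from this[of y y'] this[of y' y] show ?thesis by auto
qed

lemma partial2_le_iff: "partial2 S (x', y) \<le> partial2 S (x, y) \<longleftrightarrow> x \<le> x'"
proof
  show "partial2 S (x', y) \<le> partial2 S (x, y)" if "x \<le> x'"
    using partial2_twist[OF that, of y] eps_pos that
    by (smt (verit) mult_nonneg_nonneg mult_minus_left)
  show "x \<le> x'" if "partial2 S (x', y) \<le> partial2 S (x, y)"
  proof (rule ccontr)
    assume "\<not> x \<le> x'"
    then have "0 < \<epsilon> * (x - x')"
      using eps_pos by simp
    then show False
      using partial2_twist[of x' x y] that \<open>\<not> x \<le> x'\<close> by simp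
  qed
qed

lemma Gamma_minus_lipeomorphism: "\<exists>\<Psi>. lipeomorphism (Gamma_minus S) \<Psi>"
proof -
  have "Gamma_minus S = (\<lambda>z. (fst z, - partial1 S z))"
    by (auto simp: Gamma_minus_def)
  moreover have "\<exists>\<Psi>. lipeomorphism (\<lambda>z. (fst z, - partial1 S z)) \<Psi>"
  proof (rule lipeomorphism_fibre_map[OF _ eps_pos])
    show "boundedly_lipschitz (\<lambda>z. - partial1 S z)"
      by (intro boundedly_lipschitz_minus partial1_boundedly_lipschitz)
    show "\<epsilon> * (b' - b) \<le> - partial1 S (a, b') - - partial1 S (a, b)" if "b \<le> b'" for a b b'
      using partial1_twist[OF that, of a] by simp
  qed
  ultimately show ?thesis by simp
qed

lemma Gamma_plus_lipeomorphism: "\<exists>\<Psi>. lipeomorphism (Gamma_plus S) \<Psi>"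
proof -
  let ?swap = "\<lambda>z :: real \<times> real. (snd z, fst z)" and ?refl = "\<lambda>z :: real \<times> real. (fst z, - snd z)"
  have swap: "lipeomorphism ?swap ?swap" and refl: "lipeomorphism ?refl ?refl"
    by (auto simp: lipeomorphism_def intro!: boundedly_lipschitz_Pair boundedly_lipschitz_minus
        boundedly_lipschitz_bounded_linear bounded_linear_fst bounded_linear_snd
        bounded_linear_Pair bounded_linear_minus)
  have "\<exists>\<Psi>. lipeomorphism (\<lambda>z. (fst z, - partial2 S (?swap z))) \<Psi>"
  proof (rule lipeomorphism_fibre_map[OF _ eps_pos])
    show "boundedly_lipschitz (\<lambda>z. - partial2 S (?swap z))"
      using swap by (intro boundedly_lipschitz_minus
          boundedly_lipschitz_compose[OF _ partial2_boundedly_lipschitz]) (simp add: lipeomorphism_def)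
    show "\<epsilon> * (b' - b) \<le> - partial2 S (?swap (a, b')) - - partial2 S (?swap (a, b))"
      if "b \<le> b'" for a b b'
      using partial2_twist[OF that, of a] by simp
  qed
  then obtain \<Psi> where "lipeomorphism (\<lambda>z. (fst z, - partial2 S (?swap z))) \<Psi>"
    by blast
  from lipeomorphism_compose[OF lipeomorphism_compose[OF swap this] refl]
  have "\<exists>\<Psi>. lipeomorphism (\<lambda>z. (snd z, partial2 S (fst z, snd z))) \<Psi>"
    by auto
  moreover have "Gamma_plus S = (\<lambda>z. (snd z, partial2 S (fst z, snd z)))"
    by (auto simp: Gamma_plus_def)
  ultimately show ?thesis by simp
qed

lemma partial1_periodic: "partial1 S (x + 1, y + 1) = partial1 S (x, y)"
proof -
  have "((\<lambda>s. S (s, y)) has_real_derivative partial1 S (x + 1, y + 1)) (at x)"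
    using partial1_DERIV[of "y + 1" "x + 1"]
    by (subst (asm) DERIV_shift) (simp add: periodic)
  then show ?thesis
    using partial1_DERIV DERIV_unique by blast
qed

text \<open>By the twist condition \<open>\<partial>\<^sub>1S(s, y)\<close> exceeds its value on the diagonal, which is bounded by
periodicity, by at least \<open>\<epsilon> (s - y)\<close> for \<open>s \<ge> y\<close>, and symmetrically for \<open>s \<le> y\<close>. Integrating in
\<open>s\<close> from the diagonal gives quadratic growth.\<close>

lemma coercive:
  "\<exists>A B. \<forall>x y. \<bar>S (y, y)\<bar> \<le> A \<and> S (x, y) \<ge> \<epsilon> / 2 * (x - y)\<^sup>2 - B * \<bar>x - y\<bar> - A"
proof -
  have diag: "continuous_on UNIV (\<lambda>y. g (y, y))" if "continuous_on UNIV g"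
    for g :: "real \<times> real \<Rightarrow> real"
    by (rule continuous_on_compose2[OF that]) (auto intro!: continuous_intros)
  obtain A where A: "\<And>y. \<bar>S (y, y)\<bar> \<le> A"
    using continuous_periodic_imp_bounded[OF diag[OF continuous]] periodic by blast
  obtain B where B: "\<And>y. \<bar>partial1 S (y, y)\<bar> \<le> B"
    using continuous_periodic_imp_bounded[OF diag[OF continuous_partial1]] partial1_periodic by blast
  have "S (x, y) \<ge> \<epsilon> / 2 * (x - y)\<^sup>2 - B * \<bar>x - y\<bar> - A" for x y
  proof (cases "y \<le> x")
    case True
    let ?g = "\<lambda>s. S (s, y) + B * (s - y) - \<epsilon> / 2 * (s - y)\<^sup>2"
    have "?g y \<le> ?g x"
    proof (rule DERIV_nonneg_imp_nondecreasing[OF True])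
      fix s assume s: "y \<le> s"
      have "(?g has_real_derivative partial1 S (s, y) + B - \<epsilon> * (s - y)) (at s)"
        by (auto intro!: derivative_eq_intros partial1_DERIV simp: power2_eq_square algebra_simps)
      moreover have "partial1 S (s, y) + B - \<epsilon> * (s - y) \<ge> 0"
        using partial1_twist[OF s, of s] B[of s] by simp
      ultimately show "\<exists>D. (?g has_real_derivative D) (at s) \<and> D \<ge> 0" by blast
    qed
    then show ?thesis
      using A[of y] True by simp
  next
    case False
    let ?g = "\<lambda>s. S (s, y) - B * (s - y) - \<epsilon> / 2 * (s - y)\<^sup>2"
    from False have "x \<le> y" by simp
    then have "?g y \<le> ?g x"
    proof (rule DERIV_nonpos_imp_nonincreasing[where f = ?g])
      fix s assume s: "s \<le> y"
      have "(?g has_real_derivative partial1 S (s, y) - B - \<epsilon> * (s - y)) (at s)"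
        by (auto intro!: derivative_eq_intros partial1_DERIV simp: power2_eq_square algebra_simps)
      moreover have "partial1 S (s, y) - B - \<epsilon> * (s - y) \<le> 0"
        using partial1_twist[OF s, of s] B[of s] by (simp add: algebra_simps)
      ultimately show "\<exists>D. (?g has_real_derivative D) (at s) \<and> D \<le> 0" by blast
    qed
    then show ?thesis
      using A[of y] False by (simp add: algebra_simps)
  qed
  with A show ?thesis by blast
qed

end

section \<open>Derivatives and superdifferentials\<close>

lemma has_real_derivative_iff_eventually:
  fixes f :: "real \<Rightarrow> real"
  shows "(f has_real_derivative D) (at x) \<longleftrightarrow>
    (\<forall>e>0. \<forall>\<^sub>F y in at x. \<bar>f y - f x - D * (y - x)\<bar> \<le> e * \<bar>y - x\<bar>)"
  unfolding has_field_derivative_def has_derivative_within_alt2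
  by (simp add: bounded_linear_mult_right)

text \<open>In this form the condition has the shape of the differentiability criterion above, so that it passes
from a smooth barrier to a function below it that touches it.\<close>

lemma superdifferential_iff_eventually:
  "p \<in> superdifferential u x \<longleftrightarrow>
    (\<forall>e>0. \<forall>\<^sub>F y in at x. u y - u x - p * (y - x) \<le> e * \<bar>y - x\<bar>)"
proof
  assume p: "p \<in> superdifferential u x"
  show "\<forall>e>0. \<forall>\<^sub>F y in at x. u y - u x - p * (y - x) \<le> e * \<bar>y - x\<bar>"
  proof (intro allI impI)
    fix e :: real assume e: "0 < e"
    have "\<forall>\<^sub>F y in at x. ereal ((u y - u x - p * (y - x)) / \<bar>y - x\<bar>) < ereal e"
      using p e unfolding superdifferential_def mem_Collect_eq Limsup_le_iff
      by (metis ereal_less(2))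
    moreover have "\<forall>\<^sub>F y in at x. y \<noteq> x"
      by (rule eventually_neq_at_within)
    ultimately show "\<forall>\<^sub>F y in at x. u y - u x - p * (y - x) \<le> e * \<bar>y - x\<bar>"
      by eventually_elim (simp add: divide_less_eq)
  qed
next
  assume *: "\<forall>e>0. \<forall>\<^sub>F y in at x. u y - u x - p * (y - x) \<le> e * \<bar>y - x\<bar>"
  have "\<forall>\<^sub>F y in at x. ereal ((u y - u x - p * (y - x)) / \<bar>y - x\<bar>) < r" if r: "r > 0" for r
  proof -
    obtain e :: real where e: "0 < e" "ereal e < r"
      using ereal_dense2[OF r] by auto
    have "\<forall>\<^sub>F y in at x. u y - u x - p * (y - x) \<le> e * \<bar>y - x\<bar>"
      using * e by blast
    moreover have "\<forall>\<^sub>F y in at x. y \<noteq> x"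
      by (rule eventually_neq_at_within)
    ultimately show ?thesis
    proof eventually_elim
      case (elim y)
      then have "(u y - u x - p * (y - x)) / \<bar>y - x\<bar> \<le> e"
        by (simp add: divide_le_eq)
      then show ?case
        using e(2) by (metis ereal_less_eq(3) le_less_trans)
    qed
  qed
  then show "p \<in> superdifferential u x"
    unfolding superdifferential_def mem_Collect_eq Limsup_le_iff by blast
qed

text \<open>A form of the mean value theorem indifferent to the order of the end points, as increments of both
signs occur in one-sided and two-sided limits below.\<close>

lemma real_mean_value:
  fixes f f' :: "real \<Rightarrow> real"
  assumes "\<And>t. (f has_real_derivative f' t) (at t)"
  shows "\<exists>\<zeta>. \<bar>\<zeta> - a\<bar> \<le> \<bar>b - a\<bar> \<and> f b - f a = f' \<zeta> * (b - a)"
proof (cases a b rule: linorder_cases)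
  case less
  then obtain \<zeta> where "a < \<zeta>" "\<zeta> < b" "f b - f a = (b - a) * f' \<zeta>"
    using MVT2[of a b f f'] assms by blast
  then show ?thesis by (intro exI[of _ \<zeta>]) simp
next
  case greater
  then obtain \<zeta> where "b < \<zeta>" "\<zeta> < a" "f a - f b = (a - b) * f' \<zeta>"
    using MVT2[of b a f f'] assms by blast
  then show ?thesis by (intro exI[of _ \<zeta>]) (simp add: algebra_simps)
qed simp

section \<open>Calibrated pairs\<close>

locale weak_KAM = generating +
  fixes c k :: real and u :: "real \<Rightarrow> real"
  assumes weak_KAM_eq: "weak_KAM_eq S c k u"
begin

text \<open>\<open>w\<close> is a best predecessor of \<open>y\<close>: it attains the infimum in \<open>T\<^sup>-\<close> at \<open>y\<close>.\<close>

definition calibrated :: "real \<Rightarrow> real \<Rightarrow> bool" where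
  "calibrated w y \<longleftrightarrow> u y = u w + S_c S c (w, y) - k"

text \<open>\<open>y\<close> is a best successor of \<open>x\<close>: it attains the supremum in \<open>T\<^sup>+\<close> at \<open>x\<close>.\<close>

definition optimal :: "real \<Rightarrow> real \<Rightarrow> bool" where
  "optimal x y \<longleftrightarrow> (\<forall>z. u z - S_c S c (x, z) \<le> u y - S_c S c (x, y))"

lemma continuous_u: "continuous_on X u"
  using weak_KAM_eq unfolding weak_KAM_eq_def by (blast intro: continuous_on_subset)

text \<open>Coercivity confines the competitors in \<open>T\<^sup>-\<close> to a compact interval around the point, so the infimum
is attained and the fixed point equation of \<open>u\<close> splits into an inequality valid for all pairs and
an equality along calibrated pairs.\<close>

lemma calibration_facts:
  shows dominated: "u z \<le> u w + S_c S c (w, z) - k"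
    and calibrated_exists: "\<exists>w. calibrated w z"
    and calibrated_bounded: "\<exists>R. \<forall>w y. calibrated w y \<longrightarrow> \<bar>w - y\<bar> \<le> R"
proof -
  define \<phi> where "\<phi> y w = u w + S_c S c (w, y)" for y w
  obtain A B where AB: "\<And>x y. \<bar>S (y, y)\<bar> \<le> A \<and> S (x, y) \<ge> \<epsilon> / 2 * (x - y)\<^sup>2 - B * \<bar>x - y\<bar> - A"
    using coercive by blast
  obtain U where U: "\<And>x. \<bar>u x\<bar> \<le> U"
    using continuous_periodic_imp_bounded[OF continuous_u] weak_KAM_eq
    unfolding weak_KAM_eq_def by blast
  define b where "b = \<bar>B\<bar> + \<bar>c\<bar>"
  define D where "D = 2 * U + 2 * A"
  \<comment> \<open>Chosen so that \<open>\<epsilon>/2 t\<^sup>2 - b t > D\<close> for \<open>t > R\<close>, where \<open>D\<close> bounds what the values of \<open>u\<close> and of \<open>S\<close>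
    on the diagonal can contribute; the summand 1 ensures \<open>t \<ge> 1\<close>.\<close>
  define R where "R = (b + D) / (\<epsilon> / 2) + 1"
  have nn: "0 \<le> b" "0 \<le> D"
    using AB[of 0 0] U[of 0] by (auto simp: b_def D_def)
  have R1: "1 \<le> R"
    using nn eps_pos by (simp add: R_def)
  have far: "\<phi> y y < \<phi> y w" if R: "R < \<bar>w - y\<bar>" for w y
  proof -
    define t where "t = \<bar>w - y\<bar>"
    have t: "1 \<le> t" "(b + D) / (\<epsilon> / 2) < t"
      using R R1 by (auto simp: t_def R_def)
    then have "b + D < \<epsilon> / 2 * t"
      using eps_pos by (simp add: field_simps)
    then have "D < \<epsilon> / 2 * t - b" by simp
    also have "\<dots> \<le> t * (\<epsilon> / 2 * t - b)"
      using t(1) nn \<open>b + D < \<epsilon> / 2 * t\<close> mult_right_mono[of 1 t "\<epsilon> / 2 * t - b"] by simp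
    finally have *: "D < \<epsilon> / 2 * t\<^sup>2 - b * t"
      by (simp add: algebra_simps power2_eq_square)
    have "S (w, y) \<ge> \<epsilon> / 2 * t\<^sup>2 - B * t - A"
      using AB[of y w] by (simp add: t_def)
    moreover have "B * t \<le> \<bar>B\<bar> * t"
      using t(1) by (intro mult_right_mono) auto
    moreover have "c * (w - y) \<ge> - (\<bar>c\<bar> * t)"
      using abs_ge_minus_self[of "c * (w - y)"] by (simp add: t_def abs_mult)
    ultimately have "\<phi> y w \<ge> - U - A + (\<epsilon> / 2 * t\<^sup>2 - b * t)"
      using U[of w] by (simp add: \<phi>_def S_c_def b_def algebra_simps)
    moreover have "\<phi> y y \<le> U + A"
      using abs_le_D1[OF U[of y]] abs_le_D1[of "S (y, y)" A] AB[of y y] by (simp add: \<phi>_def S_c_def)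
    ultimately show ?thesis
      using * by (simp add: D_def)
  qed
  have min: "\<exists>w0. \<forall>w. \<phi> y w0 \<le> \<phi> y w" for y
  proof -
    have "continuous_on {y - R..y + R} (\<phi> y)"
      unfolding \<phi>_def S_c_def split_beta
      by (intro continuous_intros continuous_u continuous_on_compose2[OF continuous]) auto
    then obtain w0 where w0: "\<forall>w\<in>{y - R..y + R}. \<phi> y w0 \<le> \<phi> y w"
      using continuous_attains_inf[of "{y - R..y + R}" "\<phi> y"] R1 by auto
    have "\<phi> y w0 \<le> \<phi> y w" for w
    proof (cases "\<bar>w - y\<bar> \<le> R")
      case True
      then show ?thesis using w0 by (auto simp: abs_le_iff)
    next
      case False
      then show ?thesis using far[of w y] bspec[OF w0, of y] R1 by auto
    qed
    then show ?thesis by blast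
  qed
  have value_at_min: "u y = \<phi> y w0 - k" if "\<forall>w. \<phi> y w0 \<le> \<phi> y w" for y w0
  proof -
    have "T_minus S c u y = \<phi> y w0"
      unfolding T_minus_def \<phi>_def[symmetric] using that by (intro cInf_eq_minimum) auto
    then show ?thesis
      using weak_KAM_eq unfolding weak_KAM_eq_def by metis
  qed
  obtain w0 where w0: "\<And>y w. \<phi> y (w0 y) \<le> \<phi> y w"
    using min by metis
  have val: "u y = \<phi> y (w0 y) - k" for y
    using value_at_min w0 by blast
  show "u z \<le> u w + S_c S c (w, z) - k"
    using val[of z] w0[of z w] by (simp add: \<phi>_def)
  show "\<exists>w. calibrated w z"
    using val[of z] by (auto simp: calibrated_def \<phi>_def)
  have "\<bar>w - y\<bar> \<le> R" if "calibrated w y" for w y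
    using that far[of w y] val[of y] w0[of y y] by (fastforce simp: calibrated_def \<phi>_def)
  then show "\<exists>R. \<forall>w y. calibrated w y \<longrightarrow> \<bar>w - y\<bar> \<le> R"
    by blast
qed

text \<open>Compactness of calibrated pairs. It replaces speaking of the leftmost and the rightmost predecessor
of a point.\<close>

lemma calibrated_limit:
  assumes z: "z \<longlonglongrightarrow> y" and cal: "\<And>n. calibrated (w n) (z n)"
  shows "\<exists>w' r. strict_mono r \<and> (w \<circ> r) \<longlonglongrightarrow> w' \<and> calibrated w' y"
proof -
  obtain R where R: "\<And>n. \<bar>w n - z n\<bar> \<le> R"
    using calibrated_bounded cal by blast
  obtain K where K: "\<And>n. \<bar>z n\<bar> \<le> K"
    using convergent_imp_bounded[OF z] by (auto simp: bounded_iff)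
  have "\<bar>w n\<bar> \<le> K + R" for n
    using R[of n] K[of n] by linarith
  then have "bounded (range w)"
    by (auto simp: bounded_iff)
  then obtain w' r where r: "strict_mono r" and w': "(w \<circ> r) \<longlonglongrightarrow> w'"
    using bounded_imp_convergent_subsequence by blast
  have zr: "(z \<circ> r) \<longlonglongrightarrow> y"
    by (rule LIMSEQ_subseq_LIMSEQ[OF z r])
  have u_lim: "(\<lambda>n. u (v n)) \<longlonglongrightarrow> u a" if "v \<longlonglongrightarrow> a" for v a
    by (rule continuous_on_tendsto_compose[OF continuous_u[of UNIV] that]) auto
  have S_lim: "(\<lambda>n. S ((w \<circ> r) n, (z \<circ> r) n)) \<longlonglongrightarrow> S (w', y)"
    by (rule continuous_on_tendsto_compose[OF continuous[of UNIV] tendsto_Pair[OF w' zr]]) auto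
  have "(\<lambda>n. u ((w \<circ> r) n) + (S ((w \<circ> r) n, (z \<circ> r) n) + c * ((w \<circ> r) n - (z \<circ> r) n)) - k)
      \<longlonglongrightarrow> u w' + (S (w', y) + c * (w' - y)) - k"
    by (intro tendsto_intros u_lim S_lim w' zr)
  moreover have "u ((w \<circ> r) n) + (S ((w \<circ> r) n, (z \<circ> r) n) + c * ((w \<circ> r) n - (z \<circ> r) n)) - k
      = u ((z \<circ> r) n)" for n
    using cal[of "r n"] by (simp add: calibrated_def S_c_def)
  ultimately have "(\<lambda>n. u ((z \<circ> r) n)) \<longlonglongrightarrow> u w' + (S (w', y) + c * (w' - y)) - k"
    by simp
  then have "u y = u w' + (S (w', y) + c * (w' - y)) - k"
    using LIMSEQ_unique[OF u_lim[OF zr]] by blast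
  then have "calibrated w' y"
    by (simp add: calibrated_def S_c_def)
  then show ?thesis using r w' by blast
qed

text \<open>Aubry's crossing argument: if predecessors were in the wrong order, exchanging them would lower the
total action.\<close>

lemma calibrated_mono:
  assumes "calibrated w y" "calibrated w' y'" "y < y'"
  shows "w \<le> w'"
proof (rule ccontr)
  assume "\<not> w \<le> w'"
  then have "S (w, y') + S (w', y) < S (w, y) + S (w', y')"
    using strict_twist[of w' w y y'] assms(3) by simp
  then show False
    using assms(1,2) dominated[of y w'] dominated[of y' w]
    by (simp add: calibrated_def S_c_def algebra_simps)
qed

text \<open>In a calibrated chain \<open>w, x, y\<close> the middle point minimises the action with its neighbours fixed.\<close>

lemma calibrated_Euler_Lagrange:
  assumes "calibrated w x" "calibrated x y"
  shows "partial2 S (w, x) + partial1 S (x, y) = 0"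
proof (rule DERIV_local_min)
  let ?g = "\<lambda>s. S (w, s) + S (s, y)"
  show "(?g has_real_derivative partial2 S (w, x) + partial1 S (x, y)) (at x)"
    by (rule DERIV_add[OF partial2_DERIV partial1_DERIV])
  have "?g x \<le> ?g s" for s
    using assms dominated[of s w] dominated[of y s]
    by (simp add: calibrated_def S_c_def algebra_simps)
  then show "\<forall>s. \<bar>x - s\<bar> < 1 \<longrightarrow> ?g x \<le> ?g s" by blast
qed simp

text \<open>\<open>x\<close> itself has some predecessor \<open>w\<close>, and the Euler-Lagrange equation then determines
\<open>\<partial>\<^sub>1S(x, y)\<close>, hence \<open>y\<close>. In terms of \<open>u\<close>: a point that is a predecessor is a point of
differentiability.\<close>

lemma calibrated_target_unique:
  assumes "calibrated x y" "calibrated x y'"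
  shows "y = y'"
proof -
  obtain w where "calibrated w x"
    using calibrated_exists by blast
  then have "partial1 S (x, y) = partial1 S (x, y')"
    using calibrated_Euler_Lagrange[of w x y] calibrated_Euler_Lagrange[of w x y'] assms by simp
  then show ?thesis by (simp add: partial1_inject)
qed

text \<open>Each predecessor of \<open>y\<close> gives an upper barrier of \<open>u\<close> touching at \<open>y\<close>. By the twist condition the
barrier \<open>z \<mapsto> S_c(x, z) - S_c(x, y)\<close> for an intermediate \<open>x\<close> lies above that of \<open>w'\<close> to the
right of \<open>y\<close> and above that of \<open>w\<close> to its left.\<close>

lemma optimal_between:
  assumes "calibrated w y" "calibrated w' y" "w \<le> x" "x \<le> w'"
  shows "optimal x y"
  unfolding optimal_def
proof
  fix z
  have tw: "S (b, q) + S (a, p) \<le> S (b, p) + S (a, q)" if "a \<le> b" "p \<le> q" for a b p q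
  proof -
    have "0 \<le> \<epsilon> * (b - a) * (q - p)"
      using that eps_pos by simp
    then show ?thesis
      using twist[OF that] by simp
  qed
  show "u z - S_c S c (x, z) \<le> u y - S_c S c (x, y)"
  proof (cases "y \<le> z")
    case True
    then show ?thesis
      using tw[OF assms(4) True] dominated[of z w'] assms(2)
      by (simp add: calibrated_def S_c_def algebra_simps)
  next
    case False
    then show ?thesis
      using tw[OF assms(3), of z y] dominated[of z w] assms(1)
      by (simp add: calibrated_def S_c_def algebra_simps)
  qed
qed

lemma calibrated_imp_optimal: "calibrated w y \<Longrightarrow> optimal w y"
  using optimal_between by blast

lemma optimal_superdifferential:
  assumes "optimal x y"
  shows "partial2 S (x, y) - c \<in> superdifferential u y"
  unfolding superdifferential_iff_eventually
proof (intro allI impI)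
  fix e :: real assume "0 < e"
  then have "\<forall>\<^sub>F z in at y. \<bar>S (x, z) - S (x, y) - partial2 S (x, y) * (z - y)\<bar> \<le> e * \<bar>z - y\<bar>"
    using partial2_DERIV[of x y] unfolding has_real_derivative_iff_eventually by blast
  then show "\<forall>\<^sub>F z in at y. u z - u y - (partial2 S (x, y) - c) * (z - y) \<le> e * \<bar>z - y\<bar>"
  proof eventually_elim
    case (elim z)
    have "u z - S_c S c (x, z) \<le> u y - S_c S c (x, y)"
      using assms by (simp add: optimal_def)
    then show ?case
      using elim by (simp add: S_c_def algebra_simps)
  qed
qed

text \<open>Points \<open>z\<close> approaching \<open>y\<close> from the side of the sign \<open>s\<close> have predecessors that accumulate at a
predecessor \<open>w\<close> of \<open>y\<close>. Comparing \<open>u(z)\<close> and \<open>u(y)\<close> through the predecessor of \<open>z\<close> bounds the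
difference quotient of \<open>u\<close> from below, on the right, and from above, on the left, by a value
tending to \<open>\<partial>\<^sub>2S(w, y) - c\<close>; this limits the slopes \<open>p\<close>.\<close>

lemma superdifferential_one_sided:
  assumes p: "p \<in> superdifferential u y" and s: "\<bar>s\<bar> = 1"
  shows "\<exists>w. calibrated w y \<and> s * partial2 S (w, y) \<le> s * (c + p)"
proof -
  define z where "z n = y + s * inverse (real (Suc n))" for n
  have z_lim: "z \<longlonglongrightarrow> y"
    unfolding z_def using tendsto_add[OF tendsto_const tendsto_mult[OF tendsto_const LIMSEQ_inverse_real_of_nat]]
    by simp
  have z_abs: "\<bar>z n - y\<bar> = inverse (real (Suc n))" for n
    using s by (simp add: z_def abs_mult)
  have z_neq: "z n \<noteq> y" for n
    using z_abs[of n] by auto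
  obtain pre where "\<And>y. calibrated (pre y) y"
    using calibrated_exists by metis
  then obtain w where w: "\<And>n. calibrated (w n) (z n)"
    by (rule that[of "\<lambda>n. pre (z n)"])
  obtain w' r where r: "strict_mono r" and w': "(w \<circ> r) \<longlonglongrightarrow> w'" and cal: "calibrated w' y"
    using calibrated_limit[OF z_lim w] by blast
  have "\<exists>\<zeta>. \<bar>\<zeta> - y\<bar> \<le> \<bar>z n - y\<bar> \<and>
      S (w n, z n) - S (w n, y) = partial2 S (w n, \<zeta>) * (z n - y)" for n
    by (rule real_mean_value[of "\<lambda>t. S (w n, t)" "\<lambda>t. partial2 S (w n, t)"]) (rule partial2_DERIV)
  then obtain \<zeta> where \<zeta>: "\<And>n. \<bar>\<zeta> n - y\<bar> \<le> \<bar>z n - y\<bar>"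
    and mv: "\<And>n. S (w n, z n) - S (w n, y) = partial2 S (w n, \<zeta> n) * (z n - y)"
    by metis
  have "(\<lambda>n. \<zeta> n - y) \<longlonglongrightarrow> 0"
    by (rule Lim_null_comparison[OF _ LIMSEQ_inverse_real_of_nat])
       (use \<zeta> z_abs in simp)
  then have "\<zeta> \<longlonglongrightarrow> y"
    by (simp add: LIM_zero_iff)
  then have \<zeta>r: "(\<zeta> \<circ> r) \<longlonglongrightarrow> y"
    using r by (rule LIMSEQ_subseq_LIMSEQ)
  have lim: "(\<lambda>n. s * (partial2 S ((w \<circ> r) n, (\<zeta> \<circ> r) n) - (c + p))) \<longlonglongrightarrow>
      s * (partial2 S (w', y) - (c + p))"
    by (intro tendsto_intros
        continuous_on_tendsto_compose[OF continuous_partial2[of UNIV] tendsto_Pair[OF w' \<zeta>r]]) auto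
  have z_at: "filterlim z (at y) sequentially"
    using z_lim z_neq by (simp add: filterlim_at)
  have "s * (partial2 S (w', y) - (c + p)) \<le> e" if e: "0 < e" for e
  proof (rule tendsto_upperbound[OF lim])
    have "\<forall>\<^sub>F n in sequentially. u (z n) - u y - p * (z n - y) \<le> e * \<bar>z n - y\<bar>"
      using p e z_at unfolding superdifferential_iff_eventually filterlim_iff by blast
    then have "\<forall>\<^sub>F n in sequentially. s * (partial2 S (w n, \<zeta> n) - (c + p)) \<le> e"
    proof eventually_elim
      case (elim n)
      have "(partial2 S (w n, \<zeta> n) - c) * (z n - y) \<le> u (z n) - u y"
        using w[of n] dominated[of y "w n"] mv[of n]
        by (simp add: calibrated_def S_c_def algebra_simps)
      then have "(partial2 S (w n, \<zeta> n) - (c + p)) * (z n - y) \<le> e * \<bar>z n - y\<bar>"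
        using elim by (simp add: algebra_simps)
      then have "s * (partial2 S (w n, \<zeta> n) - (c + p)) * inverse (real (Suc n))
          \<le> e * inverse (real (Suc n))"
        unfolding z_abs by (simp add: z_def mult_ac)
      then show ?case
        by (rule mult_right_le_imp_le) simp
    qed
    then show "\<forall>\<^sub>F n in sequentially. s * (partial2 S ((w \<circ> r) n, (\<zeta> \<circ> r) n) - (c + p)) \<le> e"
      using eventually_subseq[OF r] by fastforce
  qed simp
  then have "s * (partial2 S (w', y) - (c + p)) \<le> 0"
    by (rule field_le_epsilon[of _ 0, simplified])
  then show ?thesis
    using cal by (auto simp: algebra_simps)
qed

lemma superdifferential_between:
  assumes "p \<in> superdifferential u y" "partial2 S (x, y) = c + p"
  shows "\<exists>w w'. calibrated w y \<and> calibrated w' y \<and> w \<le> x \<and> x \<le> w'"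
proof -
  obtain w where "calibrated w y" "partial2 S (x, y) \<le> partial2 S (w, y)"
    using superdifferential_one_sided[OF assms(1), of "-1"] assms(2) by auto
  moreover obtain w' where "calibrated w' y" "partial2 S (w', y) \<le> partial2 S (x, y)"
    using superdifferential_one_sided[OF assms(1), of 1] assms(2) by auto
  ultimately show ?thesis
    by (auto simp: partial2_le_iff)
qed

text \<open>The successors are thus known through the predecessors: the points with best successor \<open>y\<close> form
the interval spanned by the predecessors of \<open>y\<close>.\<close>

lemma optimal_iff_between:
  "optimal x y \<longleftrightarrow> (\<exists>w w'. calibrated w y \<and> calibrated w' y \<and> w \<le> x \<and> x \<le> w')"
proof
  show "\<exists>w w'. calibrated w y \<and> calibrated w' y \<and> w \<le> x \<and> x \<le> w'" if "optimal x y"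
    by (rule superdifferential_between[OF optimal_superdifferential[OF that]]) simp
qed (use optimal_between in blast)

text \<open>The intervals spanned by the predecessors of \<open>y < y'\<close> can meet only in a common end point, by
monotonicity; such a point would be a predecessor of both, contradicting
\<open>calibrated_target_unique\<close>.\<close>

lemma optimal_unique:
  assumes "optimal x y" "optimal x y'"
  shows "y = y'"
proof -
  have "\<not> y < y'" if opt: "optimal x y" "optimal x y'" for y y'
  proof
    assume less: "y < y'"
    obtain w1 where w1: "calibrated w1 y" "x \<le> w1"
      using opt(1) by (auto simp: optimal_iff_between)
    obtain w2 where w2: "calibrated w2 y'" "w2 \<le> x"
      using opt(2) by (auto simp: optimal_iff_between)
    have "w1 = w2"
      using calibrated_mono[OF w1(1) w2(1) less] w1(2) w2(2) by simp
    then show False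
      using calibrated_target_unique[of w1 y y'] w1 w2 less by simp
  qed
  then show ?thesis
    using assms by (metis linorder_neqE)
qed

text \<open>The points with a predecessor to the left of \<open>x\<close> and those with one to the right form two closed
sets covering the line. They meet as the line is connected, and a common point is a best successor
of \<open>x\<close> because it has predecessors on both sides.\<close>

lemma optimal_exists: "\<exists>y. optimal x y"
proof -
  let ?L = "{y. \<exists>w. calibrated w y \<and> w \<le> x}" and ?R = "{y. \<exists>w. calibrated w y \<and> x \<le> w}"
  have "closed ?L"
    unfolding closed_sequential_limits
  proof (intro allI impI, elim conjE)
    fix z y assume "\<forall>n. z n \<in> ?L" and z: "z \<longlonglongrightarrow> y"
    then obtain w where w: "\<And>n. calibrated (w n) (z n)" "\<And>n. w n \<le> x"
      by (auto; metis)
    obtain w' r where "(w \<circ> r) \<longlonglongrightarrow> w'" "calibrated w' y"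
      using calibrated_limit[OF z w(1)] by blast
    moreover from this have "w' \<le> x"
      by (intro LIMSEQ_le_const2) (use w(2) in auto)
    ultimately show "y \<in> ?L" by blast
  qed
  moreover have "closed ?R"
    unfolding closed_sequential_limits
  proof (intro allI impI, elim conjE)
    fix z y assume "\<forall>n. z n \<in> ?R" and z: "z \<longlonglongrightarrow> y"
    then obtain w where w: "\<And>n. calibrated (w n) (z n)" "\<And>n. x \<le> w n"
      by (auto; metis)
    obtain w' r where "(w \<circ> r) \<longlonglongrightarrow> w'" "calibrated w' y"
      using calibrated_limit[OF z w(1)] by blast
    moreover from this have "x \<le> w'"
      by (intro LIMSEQ_le_const) (use w(2) in auto)
    ultimately show "y \<in> ?R" by blast
  qed
  moreover have "UNIV \<subseteq> ?L \<union> ?R"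
    using calibrated_exists by (auto; meson linear)
  moreover obtain R where R: "\<And>w y. calibrated w y \<Longrightarrow> \<bar>w - y\<bar> \<le> R"
    using calibrated_bounded by blast
  have "?L \<noteq> {}"
  proof -
    obtain w where "calibrated w (x - R)"
      using calibrated_exists by blast
    moreover from R[OF this] have "w \<le> x"
      by (simp add: abs_le_iff)
    ultimately have "x - R \<in> ?L" by blast
    then show ?thesis by (rule ex_in_conv[THEN iffD1, OF exI])
  qed
  moreover have "?R \<noteq> {}"
  proof -
    obtain w where "calibrated w (x + R)"
      using calibrated_exists by blast
    moreover from R[OF this] have "x \<le> w"
      by (simp add: abs_le_iff)
    ultimately have "x + R \<in> ?R" by blast
    then show ?thesis by (rule ex_in_conv[THEN iffD1, OF exI])
  qed
  ultimately have "?L \<inter> ?R \<noteq> {}"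
    using connected_closedD[of "UNIV :: real set" ?L ?R] connected_UNIV by auto
  then obtain y where "\<exists>w. calibrated w y \<and> w \<le> x" "\<exists>w. calibrated w y \<and> x \<le> w"
    by blast
  then show ?thesis
    using optimal_between by blast
qed

lemma optimal_mono:
  assumes "optimal x y" "optimal x' y'" "x \<le> x'"
  shows "y \<le> y'"
proof (rule ccontr)
  assume "\<not> y \<le> y'"
  then have "x \<noteq> x'"
    using optimal_unique assms by auto
  then have "S (x', y) + S (x, y') < S (x', y') + S (x, y)"
    using strict_twist[of x x' y' y] assms(3) \<open>\<not> y \<le> y'\<close> by simp
  moreover have "u y' - S_c S c (x, y') \<le> u y - S_c S c (x, y)"
    "u y - S_c S c (x', y) \<le> u y' - S_c S c (x', y')"
    using assms(1,2) by (simp_all add: optimal_def)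
  ultimately show False
    by (simp add: S_c_def algebra_simps)
qed

abbreviation \<sigma> :: "real \<Rightarrow> real" where "\<sigma> \<equiv> Sigma_plus S c u"

lemma optimal_Sigma_plus: "optimal x (\<sigma> x)"
proof -
  have "\<exists>!y. optimal x y"
    using optimal_exists optimal_unique by blast
  then show ?thesis
    unfolding Sigma_plus_def optimal_def[symmetric] by (rule theI')
qed

lemma optimal_iff_Sigma_plus: "optimal x y \<longleftrightarrow> y = \<sigma> x"
  using optimal_Sigma_plus optimal_unique by blast

lemma mono_Sigma_plus: "mono \<sigma>"
  by (intro monoI optimal_mono[OF optimal_Sigma_plus optimal_Sigma_plus])

lemma surj_Sigma_plus: "surj \<sigma>"
  unfolding surj_def using calibrated_exists calibrated_imp_optimal optimal_iff_Sigma_plus by metis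

text \<open>A monotone function omitting no value cannot jump.\<close>

lemma continuous_Sigma_plus: "continuous_on UNIV \<sigma>"
  by (rule continuous_onI_mono) (use surj_Sigma_plus mono_Sigma_plus in \<open>auto dest: monoD\<close>)

lemma T_plus_eq: "T_plus S c u x = u (\<sigma> x) - S_c S c (x, \<sigma> x)"
  unfolding T_plus_def
  by (intro cSup_eq_maximum) (use optimal_Sigma_plus[of x] in \<open>auto simp: optimal_def\<close>)

text \<open>The envelope theorem. Using the best successor of one point as a competitor for the other squeezes
the increment of \<open>T\<^sup>+[u]\<close> between increments of \<open>-S_c(\<cdot>, \<sigma> x)\<close> and \<open>-S_c(\<cdot>, \<sigma> x')\<close>; the
continuity of \<open>\<sigma>\<close> makes them agree to first order.\<close>

lemma T_plus_DERIV:
  "(T_plus S c u has_real_derivative - partial1 S (x, \<sigma> x) - c) (at x)"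
  unfolding has_real_derivative_iff_eventually
proof (intro allI impI)
  fix e :: real assume e: "0 < e"
  let ?T = "T_plus S c u" and ?P = "partial1 S (x, \<sigma> x)"
  have "isCont (partial1 S) (x, \<sigma> x)"
    using continuous_partial1[of UNIV] by (simp add: continuous_on_eq_continuous_at)
  then obtain d where d: "0 < d"
    and dP: "\<And>v. dist v (x, \<sigma> x) < d \<Longrightarrow> dist (partial1 S v) ?P < e"
    using e unfolding continuous_at by (metis LIM_def dist_self)
  have near: "\<bar>partial1 S (a, b) - ?P\<bar> \<le> e" if "\<bar>a - x\<bar> < d / 2" "\<bar>b - \<sigma> x\<bar> < d / 2" for a b
  proof -
    have "dist (a, b) (x, \<sigma> x) \<le> \<bar>a - x\<bar> + \<bar>b - \<sigma> x\<bar>"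
      unfolding dist_Pair_Pair dist_real_def by (rule order_trans[OF sqrt_sum_squares_le_sum_abs]) simp
    then show ?thesis
      using dP[of "(a, b)"] that by (simp add: dist_real_def)
  qed
  have step: "\<exists>a. \<bar>a - x\<bar> \<le> \<bar>x' - x\<bar> \<and>
      S_c S c (x', b) - S_c S c (x, b) = (partial1 S (a, b) + c) * (x' - x)" for x' b
  proof -
    obtain a where "\<bar>a - x\<bar> \<le> \<bar>x' - x\<bar>" "S (x', b) - S (x, b) = partial1 S (a, b) * (x' - x)"
      using real_mean_value[of "\<lambda>s. S (s, b)" "\<lambda>s. partial1 S (s, b)" x x', OF partial1_DERIV]
      by blast
    then show ?thesis
      by (intro exI[of _ a]) (simp add: S_c_def algebra_simps)
  qed
  have err: "\<bar>S_c S c (x', b) - S_c S c (x, b) - (?P + c) * (x' - x)\<bar> \<le> e * \<bar>x' - x\<bar>"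
    if "\<bar>x' - x\<bar> < d / 2" "\<bar>b - \<sigma> x\<bar> < d / 2" for x' b
  proof -
    obtain a where a: "\<bar>a - x\<bar> \<le> \<bar>x' - x\<bar>"
      and eq: "S_c S c (x', b) - S_c S c (x, b) = (partial1 S (a, b) + c) * (x' - x)"
      using step by blast
    have "\<bar>partial1 S (a, b) - ?P\<bar> \<le> e"
      using a that by (intro near) auto
    then have "\<bar>(partial1 S (a, b) - ?P) * (x' - x)\<bar> \<le> e * \<bar>x' - x\<bar>"
      unfolding abs_mult by (rule mult_right_mono) simp
    then show ?thesis
      unfolding eq by (simp add: algebra_simps)
  qed
  have "\<forall>\<^sub>F x' in at x. \<bar>x' - x\<bar> < d / 2"
    using d by (auto simp: eventually_at dist_real_def intro!: exI[of _ "d / 2"])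
  moreover have "\<forall>\<^sub>F x' in at x. \<bar>\<sigma> x' - \<sigma> x\<bar> < d / 2"
  proof -
    have "(\<sigma> \<longlongrightarrow> \<sigma> x) (at x)"
      using continuous_Sigma_plus by (simp add: continuous_on_def)
    then show ?thesis
      using tendstoD[of \<sigma> "\<sigma> x" "at x" "d / 2"] d by (simp add: dist_real_def)
  qed
  ultimately show "\<forall>\<^sub>F x' in at x. \<bar>?T x' - ?T x - (- ?P - c) * (x' - x)\<bar> \<le> e * \<bar>x' - x\<bar>"
  proof eventually_elim
    case (elim x')
    have "?T x' \<ge> u (\<sigma> x) - S_c S c (x', \<sigma> x)" "?T x \<ge> u (\<sigma> x') - S_c S c (x, \<sigma> x')"
      using optimal_Sigma_plus[of x] optimal_Sigma_plus[of x']
      unfolding T_plus_eq by (simp_all add: optimal_def)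
    moreover have "(- ?P - c) * (x' - x) = - ((?P + c) * (x' - x))"
      by (simp add: algebra_simps)
    ultimately show ?case
      using err[OF elim(1), of "\<sigma> x"] err[OF elim] d
      unfolding T_plus_eq by (simp add: abs_le_iff)
  qed
qed

section \<open>The three graphs\<close>

lemma graph_Sigma_plus_eq: "graph_Sigma_plus S c u = range (\<lambda>x. (x, \<sigma> x))"
  by (auto simp: graph_Sigma_plus_def)

lemma graph_dT_plus_eq: "graph_dT_plus S c u = Gamma_minus S ` graph_Sigma_plus S c u"
proof -
  have "deriv (T_plus S c u) x = - partial1 S (x, \<sigma> x) - c" for x
    by (rule DERIV_imp_deriv[OF T_plus_DERIV])
  moreover have "T_plus S c u differentiable (at x)" for x
    using T_plus_DERIV real_differentiable_def by blast
  ultimately show ?thesis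
    by (auto simp: graph_dT_plus_def graph_Sigma_plus_eq Gamma_minus_def image_image)
qed

text \<open>A superdifferential \<open>p\<close> at \<open>y\<close> has the form \<open>\<partial>\<^sub>2S(x, y) - c\<close> for some \<open>x\<close> since \<open>\<Gamma>\<^sup>+\<close> is onto,
and then \<open>x\<close> lies between predecessors of \<open>y\<close>, which makes \<open>y\<close> its best successor.\<close>

lemma graph_superdifferential_eq:
  "graph_superdifferential c u = Gamma_plus S ` graph_Sigma_plus S c u"
proof (intro equalityI subsetI)
  fix v assume "v \<in> graph_superdifferential c u"
  then obtain y p where v: "v = (y, c + p)" and p: "p \<in> superdifferential u y"
    by (auto simp: graph_superdifferential_def)
  obtain \<Psi> where "\<And>w. Gamma_plus S (\<Psi> w) = w"
    using Gamma_plus_lipeomorphism by (auto simp: lipeomorphism_def)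
  then have "Gamma_plus S (\<Psi> v) = v" .
  then obtain x where x: "Gamma_plus S (x, y) = v"
    unfolding v by (cases "\<Psi> (y, c + p)") (auto simp: Gamma_plus_def)
  then have "partial2 S (x, y) = c + p"
    by (simp add: v Gamma_plus_def)
  then have "optimal x y"
    using superdifferential_between[OF p] optimal_iff_between by blast
  then show "v \<in> Gamma_plus S ` graph_Sigma_plus S c u"
    using x by (auto simp: optimal_iff_Sigma_plus graph_Sigma_plus_eq)
next
  fix v assume "v \<in> Gamma_plus S ` graph_Sigma_plus S c u"
  then obtain x where "v = (\<sigma> x, partial2 S (x, \<sigma> x))"
    by (auto simp: graph_Sigma_plus_eq Gamma_plus_def)
  moreover have "\<exists>p. partial2 S (x, \<sigma> x) = c + p \<and> p \<in> superdifferential u (\<sigma> x)"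
    using optimal_superdifferential[OF optimal_Sigma_plus, of x]
    by (intro exI[of _ "partial2 S (x, \<sigma> x) - c"]) simp
  ultimately show "v \<in> graph_superdifferential c u"
    by (auto simp: graph_superdifferential_def)
qed

lemma lipschitz_submanifold_graphs:
  "lipschitz_submanifold (graph_Sigma_plus S c u)"
  "lipschitz_submanifold (graph_dT_plus S c u)"
  "lipschitz_submanifold (graph_superdifferential c u)"
proof -
  let ?W = "(UNIV :: real set) \<times> {0 :: real}"
  have W: "subspace ?W"
    by (intro subspace_Times) auto
  obtain \<Phi> \<Psi> where \<Phi>: "lipeomorphism \<Phi> \<Psi>" and graph: "graph_Sigma_plus S c u = \<Phi> ` ?W"
    using lipeomorphism_monotone_graph[OF mono_Sigma_plus continuous_Sigma_plus]
    unfolding graph_Sigma_plus_eq by blast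
  show "lipschitz_submanifold (graph_Sigma_plus S c u)"
    unfolding graph by (rule lipschitz_submanifold_lipeomorphic_image[OF \<Phi> W])
  have "lipschitz_submanifold (\<Gamma> ` graph_Sigma_plus S c u)" if \<Gamma>: "\<exists>\<Psi>'. lipeomorphism \<Gamma> \<Psi>'"
    for \<Gamma> :: "real \<times> real \<Rightarrow> real \<times> real"
  proof -
    obtain \<Psi>' where "lipeomorphism \<Gamma> \<Psi>'"
      using \<Gamma> by blast
    from lipschitz_submanifold_lipeomorphic_image[OF lipeomorphism_compose[OF \<Phi> this] W]
    show ?thesis
      unfolding graph by (simp add: image_image)
  qed
  then show "lipschitz_submanifold (graph_dT_plus S c u)"
    "lipschitz_submanifold (graph_superdifferential c u)"
    unfolding graph_dT_plus_eq graph_superdifferential_eq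
    using Gamma_minus_lipeomorphism Gamma_plus_lipeomorphism by blast+
qed

end

theorem theorem1p5:
  fixes f :: "annulus \<Rightarrow> annulus"
    and F :: "real \<times> real \<Rightarrow> real \<times> real"
    and S :: "real \<times> real \<Rightarrow> real"
    and c :: real
    and u :: "real \<Rightarrow> real"
  assumes "twist_map f"
    and "is_lift F f"
    and "generating_function F S"
    and "weak_KAM_solution S c u"
  shows "lipschitz_submanifold (graph_Sigma_plus S c u) \<and>
    lipschitz_submanifold (graph_dT_plus S c u) \<and>
    lipschitz_submanifold (graph_superdifferential c u) \<and>
    Gamma_minus S \<in> graph_Sigma_plus S c u \<rightarrow> graph_dT_plus S c u \<and>
    Gamma_plus S \<in> graph_Sigma_plus S c u \<rightarrow> graph_superdifferential c u \<and>
    F \<in> graph_dT_plus S c u \<rightarrow> graph_superdifferential c u \<and>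
    (\<forall>z \<in> graph_Sigma_plus S c u. F (Gamma_minus S z) = Gamma_plus S z)"
proof -
  have "C2_on UNIV S" and "\<And>x y. S (x + 1, y + 1) = S (x, y)"
    and ex: "\<exists>\<epsilon>>0. \<forall>x y. partial1 (partial2 S) (x, y) < - \<epsilon>"
    and F: "\<And>x p y p'. F (x, p) = (y, p') \<longleftrightarrow> p = - partial1 S (x, y) \<and> p' = partial2 S (x, y)"
    using assms(3) unfolding generating_function_def by blast+
  moreover obtain \<epsilon> where "0 < \<epsilon>" "\<And>x y. partial1 (partial2 S) (x, y) < - \<epsilon>"
    using ex by blast
  ultimately interpret weak_KAM S \<epsilon> c "S_bar S c" u
    using assms(4) by unfold_locales (simp_all add: weak_KAM_solution_def)
  have "F (Gamma_minus S z) = Gamma_plus S z" for z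
    by (cases z) (simp add: Gamma_minus_def Gamma_plus_def F)
  then show ?thesis
    using lipschitz_submanifold_graphs
    unfolding graph_dT_plus_eq graph_superdifferential_eq by auto
qed

end
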